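(* Let $p>1$. For $(N,D)\in(-1,1)\times(-1,1)$ let $W_{\alpha(N,D)}$ be the weighted shift with weights $\alpha_n = \sqrt{\frac{p^n+N}{p^n+D}}$, $n=0,1,2,\ldots$. Consider only multipliers of the weights such that, after the multiplication and the application of $\Delta^2$ to the moment sequence, the new weights squared are non-negative. (1) Let $(N,D)$ satisfy $-1 < p^2N \le D \le pN < 0$ (so that $(N,D)$ is a point in subsector VIIIB). If $(N,D)$ is not on the special line $D = pN$, there is exactly one non-zero constant multiple of the weights of $W_{\alpha(N,D)}$, namely by $\sqrt{p}$, so that the resulting shift is conditionally positive definite (CPD). (2) If $(N,D)$ as in (1) is on the special line $D=pN$, there are exactly two non-zero multipliers of the weights, namely $1$ and $\sqrt{p}$, so that the shift resulting after the multiplication and the application of $\Delta^2$ is subnormal. (3) If $(N,D)$ is any point of $(-1,1)\times(-1,1)$ not in subsector VIIIB, not in Sectors I, II, and III, and not on the special lines in Sector IV, then there is no non-zero multiplier of the weights of $W_{\alpha(N,D)}$ rendering it CPD.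
   Context: A weighted shift $W_\alpha$ with positive weights acts on $\ell^2$ by $W_\alpha e_j = \alpha_j e_{j+1}$ ($j\ge0$), with moments $\gamma_0=1$, $\gamma_j=\prod_{i=0}^{j-1}\alpha_i^2$. Multipliers of the weights are positive constants $\sqrt{k}$, $k>0$; multiplying by $\sqrt k$ replaces $\gamma_n$ by $k^n\gamma_n$. For a sequence $c$, $(\Delta c)_n=c_{n+1}-c_n$, $\Delta^2 c=\Delta(\Delta c)$. The shift "resulting after $\Delta^2$" from a moment sequence $\hat\gamma$ is the one whose weights squared are the ratios $(\Delta^2\hat\gamma)_{n+1}/(\Delta^2\hat\gamma)_n$ (only the weights matter, so $\Delta^2\hat\gamma$ itself may be a sequence of negative numbers); "the new weights squared" are these ratios. A weighted shift is subnormal iff its moments are the power moments of a probability measure compactly supported in $[0,\infty)$. A weighted shift with moments $\gamma$ is conditionally positive definite (CPD) if for all $k\ge1$, $m\ge0$ and all vectors $(v_0,\ldots,v_k)$ with $\sum_{i=0}^k v_i=0$ one has $\sum_{i,j=0}^k \gamma_{m+i+j}v_i\overline{v_j}\ge0$; equivalently (in the presence of the growth condition satisfied here) $\Delta^2\gamma$ is positive definite, i.e. a moment sequence of a positive measure on $[0,\infty)$. Regions of the square $(-1,1)\times(-1,1)$ (coordinates $(N,D)$): Sector I: $N\le D\le 0$; Sector II: $N\le0$, $0\le D\le -N$; Sector III: $N\le0$, $D\ge -N$ (so Sectors I, II, III together form $\{N\le 0,\ D\ge N\}$); Sector IV: $N>0$, $D\ge N$, whose special lines are $D=p^nN$, $n=0,1,2,\ldots$;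 subsector VIIIB: the part of the third quadrant bounded above by the line $D=pN$ and below by the line $D=p^2N$, i.e. $N<0$, $p^2N\le D\le pN$. *)

theory Defs
  imports "HOL-Probability.Probability"
begin

text \<open>
  A weighted shift is represented by its weight sequence: every notion used here (moments,
  subnormality, conditional positive definiteness) depends on the weights only.
\<close>

definition shift_moment :: "(nat \<Rightarrow> real) \<Rightarrow> nat \<Rightarrow> real" where
  "shift_moment \<alpha> n = (\<Prod>i<n. (\<alpha> i)\<^sup>2)"

definition forward_diff :: "(nat \<Rightarrow> real) \<Rightarrow> nat \<Rightarrow> real" where
  "forward_diff c n = c (Suc n) - c n"

abbreviation forward_diff2 :: "(nat \<Rightarrow> real) \<Rightarrow> nat \<Rightarrow> real" where
  "forward_diff2 c \<equiv> forward_diff (forward_diff c)"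

text \<open>
  Subnormality through the Berger measure: the moments of the shift are the power moments of a
  probability measure carried by a compact subset of the nonnegative half-line.
\<close>

definition subnormal_shift :: "(nat \<Rightarrow> real) \<Rightarrow> bool" where
  "subnormal_shift \<alpha> \<longleftrightarrow>
     (\<exists>\<mu> :: real measure. prob_space \<mu> \<and> sets \<mu> = sets borel \<and>
        (\<exists>K. compact K \<and> K \<subseteq> {0..} \<and> (AE t in \<mu>. t \<in> K)) \<and>
        (\<forall>n. shift_moment \<alpha> n = (LINT t|\<mu>. t ^ n)))"

definition cpd_shift :: "(nat \<Rightarrow> real) \<Rightarrow> bool" where
  "cpd_shift \<alpha> \<longleftrightarrow>
     (\<forall>k\<ge>1. \<forall>m. \<forall>v :: nat \<Rightarrow> complex. (\<Sum>i\<le>k. v i) = 0 \<longrightarrow>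
        (\<Sum>i\<le>k. \<Sum>j\<le>k. of_real (shift_moment \<alpha> (m + i + j)) * v i * cnj (v j)) \<in> \<real>\<^sub>\<ge>\<^sub>0)"

definition mult_weights :: "real \<Rightarrow> (nat \<Rightarrow> real) \<Rightarrow> nat \<Rightarrow> real" where
  "mult_weights c \<alpha> n = c * \<alpha> n"

definition diff2_weights_sq :: "(nat \<Rightarrow> real) \<Rightarrow> nat \<Rightarrow> real" where
  "diff2_weights_sq \<alpha> n =
     forward_diff2 (shift_moment \<alpha>) (Suc n) / forward_diff2 (shift_moment \<alpha>) n"

definition diff2_weights :: "(nat \<Rightarrow> real) \<Rightarrow> nat \<Rightarrow> real" where
  "diff2_weights \<alpha> n = sqrt (diff2_weights_sq \<alpha> n)"

text \<open>
  The multipliers under consideration.  The second differences may all be negative, but none may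
  vanish: otherwise a new squared weight would be an undefined quotient, which division by zero
  being zero in HOL would silently turn into a nonnegative number.
\<close>

definition admissible_multiplier :: "(nat \<Rightarrow> real) \<Rightarrow> real \<Rightarrow> bool" where
  "admissible_multiplier \<alpha> c \<longleftrightarrow> c > 0 \<and>
     (\<forall>n. forward_diff2 (shift_moment (mult_weights c \<alpha>)) n \<noteq> 0 \<and>
          diff2_weights_sq (mult_weights c \<alpha>) n \<ge> 0)"

definition ND_weights :: "real \<Rightarrow> real \<Rightarrow> real \<Rightarrow> nat \<Rightarrow> real" where
  "ND_weights p N D n = sqrt ((p ^ n + N) / (p ^ n + D))"

definition ND_square :: "(real \<times> real) set" where
  "ND_square = {-1<..<1} \<times> {-1<..<1}"

definition sector_I :: "(real \<times> real) set" where
  "sector_I = {(N, D) \<in> ND_square. N \<le> D \<and> D \<le> 0}"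

definition sector_II :: "(real \<times> real) set" where
  "sector_II = {(N, D) \<in> ND_square. N \<le> 0 \<and> 0 \<le> D \<and> D \<le> - N}"

definition sector_III :: "(real \<times> real) set" where
  "sector_III = {(N, D) \<in> ND_square. N \<le> 0 \<and> D \<ge> - N}"

definition sector_IV :: "(real \<times> real) set" where
  "sector_IV = {(N, D) \<in> ND_square. N > 0 \<and> D \<ge> N}"

definition special_lines_IV :: "real \<Rightarrow> (real \<times> real) set" where
  "special_lines_IV p = {(N, D) \<in> sector_IV. \<exists>n::nat. D = p ^ n * N}"

definition subsector_VIIIB :: "real \<Rightarrow> (real \<times> real) set" where
  "subsector_VIIIB p = {(N, D) \<in> ND_square. N < 0 \<and> p\<^sup>2 * N \<le> D \<and> D \<le> p * N}"

end

theory Submission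
  imports Defs
begin

text \<open>
  With \<open>q = 1 / p\<close>, the \<open>q\<close>-binomial theorem writes the moments of the shift as
  \<open>C * (\<Sum>j. c\<^sub>j * (q ^ j) ^ n)\<close> where \<open>C > 0\<close> and \<open>c\<^sub>j\<close> is the product over \<open>i < j\<close> of
  \<open>(D * q ^ i - N) / (1 - q ^ Suc i)\<close>, that is, as the moments of a signed measure with atoms
  at the powers of \<open>q\<close>.  Multiplying the weights by \<open>sqrt k\<close> moves the atoms to
  \<open>k * q ^ j\<close>, and \<open>\<Delta>\<^sup>2\<close> multiplies their masses by \<open>(k * q ^ j - 1)\<^sup>2\<close>.  So the multiplier
  can remove one atom, namely \<open>j\<close> for \<open>k = p ^ j\<close>, and the result is CPD iff the remaining
  \<open>c\<^sub>j\<close> are nonnegative.  In subsector VIIIB the only negative coefficient is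
  \<open>c\<^sub>1\<close>; in case (3) there are at least two of them.  On the line \<open>D = p * N\<close> only \<open>c\<^sub>0 > 0 > c\<^sub>1\<close>
  survive, and one of them has to be removed.
\<close>

section \<open>Hankel forms of signed atomic measures and the CPD condition\<close>

text \<open>For the signed measure with masses \<open>a l\<close> at \<open>x l\<close>, the Hankel
  form is the integral of \<open>t ^ m\<close> times the squared modulus of the polynomial with
  coefficients \<open>v\<close>. The double sum is finite, so it passes through the series term by
  term.\<close>

lemma hankel_form_sums:
  fixes a x G :: "nat \<Rightarrow> real" and v :: "nat \<Rightarrow> complex"
  assumes G: "\<And>n. (\<lambda>l. a l * x l ^ n) sums G n"
  shows "(\<lambda>l. complex_of_real (a l * x l ^ m * (cmod (\<Sum>i\<le>k. v i * of_real (x l) ^ i))\<^sup>2)) sums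
    (\<Sum>i\<le>k. \<Sum>j\<le>k. of_real (G (m + i + j)) * v i * cnj (v j))"
proof -
  have "complex_of_real (a l * x l ^ m * (cmod (\<Sum>i\<le>k. v i * of_real (x l) ^ i))\<^sup>2) =
    (\<Sum>i\<le>k. \<Sum>j\<le>k. of_real (a l * x l ^ (m + i + j)) * v i * cnj (v j))" for l
  proof -
    have "complex_of_real (a l * x l ^ m * (cmod (\<Sum>i\<le>k. v i * of_real (x l) ^ i))\<^sup>2) =
      of_real (a l * x l ^ m) * ((\<Sum>i\<le>k. v i * of_real (x l) ^ i) *
        (\<Sum>j\<le>k. cnj (v j) * of_real (x l) ^ j))"
      by (simp add: complex_norm_square del: of_real_power)
    also have "\<dots> = (\<Sum>i\<le>k. \<Sum>j\<le>k. of_real (a l * x l ^ (m + i + j)) * v i * cnj (v j))"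
      unfolding sum_product unfolding sum_distrib_left
      by (intro sum.cong refl) (simp add: power_add mult_ac)
    finally show ?thesis .
  qed
  moreover have "(\<lambda>l. \<Sum>i\<le>k. \<Sum>j\<le>k. of_real (a l * x l ^ (m + i + j)) * v i * cnj (v j)) sums
    (\<Sum>i\<le>k. \<Sum>j\<le>k. of_real (G (m + i + j)) * v i * cnj (v j))"
    by (intro sums_sum sums_mult2 sums_of_real G)
  ultimately show ?thesis
    by simp
qed

text \<open>The mass at 1 may have any sign: when the entries of \<open>v\<close> sum to 0, their
  polynomial vanishes at 1.\<close>

lemma cpd_shiftI:
  fixes a x :: "nat \<Rightarrow> real"
  assumes G: "\<And>n. (\<lambda>l. a l * x l ^ n) sums shift_moment \<beta> n"
    and x: "\<And>l. x l \<ge> 0" and a: "\<And>l. x l \<noteq> 1 \<Longrightarrow> a l \<ge> 0"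
  shows "cpd_shift \<beta>"
  unfolding cpd_shift_def
proof (intro allI impI)
  fix k m :: nat and v :: "nat \<Rightarrow> complex"
  assume v: "(\<Sum>i\<le>k. v i) = 0"
  let ?t = "\<lambda>l. a l * x l ^ m * (cmod (\<Sum>i\<le>k. v i * of_real (x l) ^ i))\<^sup>2"
  let ?S = "\<Sum>i\<le>k. \<Sum>j\<le>k. of_real (shift_moment \<beta> (m + i + j)) * v i * cnj (v j)"
  have S: "(\<lambda>l. complex_of_real (?t l)) sums ?S"
    using hankel_form_sums[OF G] .
  have t: "?t l \<ge> 0" for l
    using x a v by (cases "x l = 1") (auto intro!: mult_nonneg_nonneg)
  have "?t sums Re ?S"
    using sums_Re[OF S] by (simp only: Re_complex_of_real)
  then have "Re ?S \<ge> 0"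
    by (rule sums_le[OF t sums_zero])
  moreover have "Im ?S = 0"
    using sums_unique2[OF sums_Im[OF S], of 0] by (simp only: Im_complex_of_real sums_zero)
  ultimately show "?S \<in> \<real>\<^sub>\<ge>\<^sub>0"
    by (simp only: complex_nonneg_Reals_iff)
qed

text \<open>The real test vectors of sum 0 are the coefficient vectors of the real polynomials with
  root 1. Summability is stated along with the sign because the value of \<open>suminf\<close> is
  meaningful only then.\<close>

lemma cpd_shift_poly_nonneg:
  fixes a x :: "nat \<Rightarrow> real" and P :: "real poly"
  assumes G: "\<And>n. (\<lambda>l. a l * x l ^ n) sums shift_moment \<beta> n"
    and cpd: "cpd_shift \<beta>" and P: "poly P 1 = 0"
  shows "summable (\<lambda>l. a l * x l ^ m * (poly P (x l))\<^sup>2)"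
    and "(\<Sum>l. a l * x l ^ m * (poly P (x l))\<^sup>2) \<ge> 0"
proof -
  \<comment> \<open>The extra zero coefficient guarantees \<open>k \<ge> 1\<close>, even for
    \<open>P = 0\<close>.\<close>
  define k where "k = Suc (degree P)"
  define v where "v i = complex_of_real (coeff P i)" for i
  have ev: "(\<Sum>i\<le>k. v i * of_real y ^ i) = of_real (poly P y)" for y
    by (simp add: v_def k_def poly_altdef coeff_eq_0)
  let ?S = "\<Sum>i\<le>k. \<Sum>j\<le>k. of_real (shift_moment \<beta> (m + i + j)) * v i * cnj (v j)"
  have "(\<Sum>i\<le>k. v i) = 0"
    using ev[of 1] P by simp
  then have "?S \<in> \<real>\<^sub>\<ge>\<^sub>0"
    using cpd[unfolded cpd_shift_def, THEN spec, of k] by (simp add: k_def del: sum.atMost_Suc)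
  then have "Re ?S \<ge> 0"
    by (simp add: complex_nonneg_Reals_iff)
  moreover have "(\<lambda>l. complex_of_real (a l * x l ^ m * (poly P (x l))\<^sup>2)) sums ?S"
    using hankel_form_sums[OF G, where m = m and k = k and v = v] by (simp add: ev)
  from sums_Re[OF this] have "(\<lambda>l. a l * x l ^ m * (poly P (x l))\<^sup>2) sums Re ?S"
    by (simp only: Re_complex_of_real)
  ultimately show "summable (\<lambda>l. a l * x l ^ m * (poly P (x l))\<^sup>2)"
    and "(\<Sum>l. a l * x l ^ m * (poly P (x l))\<^sup>2) \<ge> 0"
    by (auto simp: sums_iff)
qed

lemma cpd_shift_coeff_nonneg:
  fixes a x :: "nat \<Rightarrow> real"
  assumes G: "\<And>n. (\<lambda>l. a l * x l ^ n) sums shift_moment \<beta> n"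
    and a: "summable (\<lambda>l. \<bar>a l\<bar>)"
    and pos: "\<And>l. x l > 0" and dec: "\<And>i j. i < j \<Longrightarrow> x j < x i"
    and cpd: "cpd_shift \<beta>" and l: "x l \<noteq> 1"
  shows "a l \<ge> 0"
proof (rule ccontr)
  \<comment> \<open>Test with a polynomial vanishing at 1 and at all larger atoms: for large \<open>m\<close> the atom
    \<open>x l\<close> dominates.\<close>
  assume "\<not> a l \<ge> 0"
  define P :: "real poly" where "P = [:-1, 1:] * (\<Prod>j<l. [:- x j, 1:])"
  have P1: "poly P 1 = 0"
    by (simp add: P_def)
  have Pj: "poly P (x j) = 0" if "j < l" for j
    using that by (auto simp: P_def poly_prod)
  have Pl: "poly P (x l) \<noteq> 0"
    using l dec by (force simp: P_def poly_prod)
  define b where "b j = a j * (poly P (x j))\<^sup>2" for j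
  have bl: "b l < 0"
    using \<open>\<not> a l \<ge> 0\<close> Pl by (simp add: b_def mult_neg_pos)
  \<comment> \<open>All atoms lie in \<open>{0..x 0}\<close>, where the square of \<open>P\<close>
    is bounded, so the weighted masses \<open>b\<close> inherit absolute summability from
    \<open>a\<close>.\<close>
  have "bounded ((\<lambda>t. (poly P t)\<^sup>2) ` {0..x 0})"
    by (intro compact_imp_bounded compact_continuous_image continuous_intros) auto
  then obtain M where M: "\<And>t. t \<in> {0..x 0} \<Longrightarrow> (poly P t)\<^sup>2 \<le> M"
    unfolding bounded_iff by fastforce
  have "x j \<in> {0..x 0}" for j
    using pos[of j] dec[of 0 j] by (cases j) auto
  then have "norm \<bar>b j\<bar> \<le> \<bar>a j\<bar> * M" for j
    using M by (auto simp: b_def abs_mult intro!: mult_left_mono)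
  then have bs: "summable (\<lambda>j. \<bar>b j\<bar>)"
    by (intro summable_comparison_test'[OF summable_mult2[OF a]])
  define B where "B = (\<Sum>j. \<bar>b j\<bar>)"
  define y where "y = x (Suc l)"
  have y: "0 < y" "y < x l"
    using pos dec by (auto simp: y_def)
  \<comment> \<open>Atoms before \<open>l\<close> are roots of \<open>P\<close> and those after
    \<open>l\<close> are at most \<open>y\<close>. Nonnegativity of the test series, divided by
    \<open>x l ^ m\<close>, gives this bound, whose right side tends to 0.\<close>
  have main: "- b l \<le> (y / x l) ^ m * B" for m
  proof -
    have le: "a j * x j ^ m * (poly P (x j))\<^sup>2 \<le>
      (if j = l then b l * x l ^ m else 0) + \<bar>b j\<bar> * y ^ m" for j
    proof -
      consider "j < l" | "j = l" | "j > l" by linarith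
      then show ?thesis
      proof cases
        case 1
        then show ?thesis using Pj y by simp
      next
        case 2
        then show ?thesis using y by (simp add: b_def)
      next
        case 3
        then have "x j \<le> y"
          using dec[of "Suc l" j] by (cases "j = Suc l") (auto simp: y_def)
        then have "\<bar>b j\<bar> * x j ^ m \<le> \<bar>b j\<bar> * y ^ m"
          using pos[of j] by (intro mult_left_mono power_mono) auto
        moreover have "b j * x j ^ m \<le> \<bar>b j\<bar> * x j ^ m"
          using pos[of j] by (intro mult_right_mono) auto
        ultimately show ?thesis
          using 3 by (simp add: b_def mult_ac)
      qed
    qed
    have s: "(\<lambda>j. (if j = l then b l * x l ^ m else 0) + \<bar>b j\<bar> * y ^ m) sums (b l * x l ^ m + B * y ^ m)"
      unfolding B_def
      by (intro sums_add sums_mult2 summable_sums bs) (rule sums_single)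
    have "0 \<le> (\<Sum>j. a j * x j ^ m * (poly P (x j))\<^sup>2)"
      using cpd_shift_poly_nonneg(2)[OF G cpd P1] .
    also have "\<dots> \<le> b l * x l ^ m + B * y ^ m"
      using suminf_le[OF le cpd_shift_poly_nonneg(1)[OF G cpd P1] sums_summable[OF s]]
        sums_unique[OF s] by simp
    finally show ?thesis
      using pos[of l] by (simp add: field_simps power_divide)
  qed
  have "(\<lambda>m. (y / x l) ^ m * B) \<longlonglongrightarrow> 0 * B"
    using y by (intro tendsto_mult LIMSEQ_realpow_zero tendsto_const) auto
  then have "- b l \<le> 0"
    using LIMSEQ_le_const main by fastforce
  with bl show False by simp
qed

section \<open>The coefficients of the q-binomial series\<close>

text \<open>For nonzero \<open>N\<close> this is \<open>(- N) ^ j\<close> times the quotient of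
  q-Pochhammer symbols (D/N; q)_j / (q; q)_j. The form chosen here also covers
  \<open>N = 0\<close>.\<close>

definition qcoeff :: "real \<Rightarrow> real \<Rightarrow> real \<Rightarrow> nat \<Rightarrow> real" where
  "qcoeff q N D j = (\<Prod>i<j. (D * q ^ i - N) / (1 - q ^ Suc i))"

lemma qcoeff_Suc: "qcoeff q N D (Suc j) = qcoeff q N D j * ((D * q ^ j - N) / (1 - q ^ Suc j))"
  by (simp add: qcoeff_def)

text \<open>The ratio of consecutive coefficients tends to \<open>- N\<close>, of modulus below
  1.\<close>

lemma summable_qcoeff:
  assumes q: "0 < q" "q < 1" and N: "\<bar>N\<bar> < 1"
  shows "summable (\<lambda>j. \<bar>qcoeff q N D j\<bar>)"
proof -
  have q0: "(\<lambda>j. q ^ j) \<longlonglongrightarrow> 0"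
    using q by (intro LIMSEQ_realpow_zero) auto
  have "(\<lambda>j. \<bar>(D * q ^ j - N) / (1 - q ^ Suc j)\<bar>) \<longlonglongrightarrow> \<bar>(D * 0 - N) / (1 - 0)\<bar>"
    by (intro tendsto_intros q0 LIMSEQ_Suc[OF q0]) auto
  moreover obtain r where r: "\<bar>N\<bar> < r" "r < 1"
    using N dense by blast
  ultimately have "\<forall>\<^sub>F j in sequentially. \<bar>(D * q ^ j - N) / (1 - q ^ Suc j)\<bar> < r"
    by (intro order_tendstoD) auto
  then obtain n where n: "\<And>j. j \<ge> n \<Longrightarrow> \<bar>(D * q ^ j - N) / (1 - q ^ Suc j)\<bar> < r"
    by (auto simp: eventually_sequentially)
  show ?thesis
  proof (rule summable_ratio_test[OF r(2)])
    fix j assume "n \<le> j"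
    then show "norm \<bar>qcoeff q N D (Suc j)\<bar> \<le> r * norm \<bar>qcoeff q N D j\<bar>"
      using mult_left_mono[OF less_imp_le[OF n], of j "\<bar>qcoeff q N D j\<bar>"]
      unfolding qcoeff_Suc abs_mult by (simp add: mult.commute)
  qed
qed

text \<open>
  A form of the \<open>q\<close>-binomial theorem: the generating function \<open>f\<close> of the coefficients satisfies
  \<open>(1 + N z) f z = (1 + D z) f (q z)\<close>, and iterating this along \<open>z = q ^ n\<close> gives \<open>f (q ^ n)\<close>.
\<close>

lemma qcoeff_sums:
  assumes q: "0 < q" "q < 1" and N: "\<bar>N\<bar> < 1" and D: "\<bar>D\<bar> < 1"
  obtains C where "C > 0"
    "\<And>n. (\<lambda>j. C * qcoeff q N D j * (q ^ j) ^ n) sums (\<Prod>i<n. (1 + N * q ^ i) / (1 + D * q ^ i))"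
proof -
  let ?c = "qcoeff q N D" and ?g = "\<lambda>n. \<Prod>i<n. (1 + N * q ^ i) / (1 + D * q ^ i)"
  define f where "f z = (\<Sum>j. ?c j * z ^ j)" for z
  have sm: "summable (\<lambda>j. ?c j * z ^ j)" if "\<bar>z\<bar> \<le> 1" for z
  proof (rule summable_comparison_test'[OF summable_qcoeff[OF q N]])
    fix j show "norm (?c j * z ^ j) \<le> \<bar>?c j\<bar>"
      using that by (simp add: abs_mult power_abs mult_left_le power_le_one)
  qed
  have fe: "(1 + N * z) * f z = (1 + D * z) * f (q * z)" if z: "\<bar>z\<bar> \<le> 1" for z
  proof -
    have qz: "\<bar>q * z\<bar> \<le> 1"
      using q z by (simp add: abs_mult mult_le_one)
    have "(\<lambda>j. ?c (Suc j) * z ^ Suc j + N * z * (?c j * z ^ j)) sums (f z - ?c 0 + N * z * f z)"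
      using summable_sums[OF sm[OF z]] unfolding f_def
      by (intro sums_add sums_mult) (subst sums_Suc_iff, simp_all)
    moreover have "(\<lambda>j. ?c (Suc j) * (q * z) ^ Suc j + D * z * (?c j * (q * z) ^ j)) sums
        (f (q * z) - ?c 0 + D * z * f (q * z))"
      using summable_sums[OF sm[OF qz]] unfolding f_def
      by (intro sums_add sums_mult) (subst sums_Suc_iff, simp_all)
    \<comment> \<open>The recursion for the coefficients, multiplied by \<open>z ^ Suc j\<close>,
      matches the two series of the functional equation term by term.\<close>
    moreover have "?c (Suc j) * z ^ Suc j + N * z * (?c j * z ^ j) =
        ?c (Suc j) * (q * z) ^ Suc j + D * z * (?c j * (q * z) ^ j)" for j
    proof -
      have "q ^ Suc j < 1"
        using q power_Suc_less_one by blast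
      then have "?c (Suc j) * (1 - q ^ Suc j) = ?c j * (D * q ^ j - N)"
        unfolding qcoeff_Suc by simp
      then have "?c (Suc j) * (1 - q ^ Suc j) * z ^ Suc j = ?c j * (D * q ^ j - N) * z ^ Suc j"
        by simp
      then show ?thesis
        by (simp add: algebra_simps power_mult_distrib)
    qed
    ultimately have "f z - ?c 0 + N * z * f z = f (q * z) - ?c 0 + D * z * f (q * z)"
      by (simp add: sums_iff)
    then show ?thesis
      by (simp add: algebra_simps)
  qed
  have pos: "1 + M * q ^ i > 0" if "\<bar>M\<bar> < 1" for M i
  proof -
    have "\<bar>M * q ^ i\<bar> \<le> \<bar>M\<bar>"
      using q by (simp add: abs_mult mult_left_le power_le_one)
    then show ?thesis
      using that by linarith
  qed
  have fg: "f (q ^ n) = f 1 * ?g n" for n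
  proof (induction n)
    case (Suc n)
    have "\<bar>q ^ n\<bar> \<le> 1"
      using q by (simp add: power_le_one)
    from fe[OF this] have "f (q ^ Suc n) = f (q ^ n) * ((1 + N * q ^ n) / (1 + D * q ^ n))"
      using pos[OF D, of n] by (simp add: field_simps)
    then show ?case
      using Suc by simp
  qed simp
  have gpos: "?g n > 0" for n
    by (intro prod_pos) (simp add: pos N D)
  \<comment> \<open>Continuity gives \<open>f (q ^ n)\<close> the limit \<open>f 0 = 1\<close>, so
    some value \<open>f 1 * ?g n\<close> is positive; as \<open>?g n > 0\<close>, also
    \<open>f 1 > 0\<close>.\<close>
  have "isCont f 0"
    unfolding f_def by (rule isCont_powser[of ?c 1]) (use sm[of 1] in simp_all)
  moreover have "(\<lambda>n. q ^ n) \<longlonglongrightarrow> 0"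
    using q by (intro LIMSEQ_realpow_zero) auto
  ultimately have "(\<lambda>n. f (q ^ n)) \<longlonglongrightarrow> f 0"
    by (rule isCont_tendsto_compose)
  moreover have "f 0 = 1"
    by (simp add: f_def powser_zero qcoeff_def)
  ultimately have "\<forall>\<^sub>F n in sequentially. f (q ^ n) > 0"
    by (intro order_tendstoD(1)) auto
  then obtain n where "f (q ^ n) > 0"
    by (auto simp: eventually_sequentially)
  then have f1: "f 1 > 0"
    using fg[of n] gpos[of n] by (simp add: zero_less_mult_iff)
  show thesis
  proof (rule that[of "1 / f 1"])
    fix n
    have "\<bar>q ^ n\<bar> \<le> 1"
      using q by (simp add: power_le_one)
    then have "(\<lambda>j. ?c j * (q ^ n) ^ j) sums f (q ^ n)"
      unfolding f_def by (intro summable_sums sm)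
    then have "(\<lambda>j. 1 / f 1 * (?c j * (q ^ n) ^ j)) sums (1 / f 1 * f (q ^ n))"
      by (rule sums_mult)
    \<comment> \<open>Swapping exponents, \<open>(q ^ n) ^ j = (q ^ j) ^ n\<close>, turns the power
      series at \<open>q ^ n\<close> into the n-th moment of masses at the points
      \<open>q ^ j\<close>.\<close>
    then show "(\<lambda>j. 1 / f 1 * ?c j * (q ^ j) ^ n) sums ?g n"
      using f1 by (simp add: fg power_mult[symmetric] mult.commute)
  qed (use f1 in simp)
qed


section \<open>Second differences and subnormality\<close>

lemma forward_diff2_eq: "forward_diff2 c n = c (Suc (Suc n)) - 2 * c (Suc n) + c n"
  by (simp add: forward_diff_def)

lemma forward_diff2_sums:
  fixes a x :: "nat \<Rightarrow> real"
  assumes "\<And>n. (\<lambda>l. a l * x l ^ n) sums G n"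
  shows "(\<lambda>l. a l * (x l - 1)\<^sup>2 * x l ^ n) sums forward_diff2 G n"
proof -
  have "(\<lambda>l. a l * x l ^ Suc (Suc n) - 2 * (a l * x l ^ Suc n) + a l * x l ^ n) sums forward_diff2 G n"
    unfolding forward_diff2_eq by (intro sums_add sums_diff sums_mult assms)
  then show ?thesis
    by (simp add: algebra_simps power2_eq_square)
qed

text \<open>The squared weights telescope. Admissibility makes the square of each
  \<open>sqrt\<close> its argument and each cancelled factor nonzero; dividing by the value at 0
  removes a common sign.\<close>

lemma shift_moment_diff2_weights:
  assumes "admissible_multiplier \<alpha> c"
  shows "shift_moment (diff2_weights (mult_weights c \<alpha>)) n =
    forward_diff2 (shift_moment (mult_weights c \<alpha>)) n /
    forward_diff2 (shift_moment (mult_weights c \<alpha>)) 0"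
proof (induction n)
  case 0
  then show ?case
    using assms by (simp add: admissible_multiplier_def shift_moment_def[of "diff2_weights _"])
next
  case (Suc n)
  have "shift_moment (diff2_weights (mult_weights c \<alpha>)) (Suc n) =
    shift_moment (diff2_weights (mult_weights c \<alpha>)) n * diff2_weights_sq (mult_weights c \<alpha>) n"
    using assms by (simp add: admissible_multiplier_def shift_moment_def diff2_weights_def)
  also have "\<dots> = forward_diff2 (shift_moment (mult_weights c \<alpha>)) (Suc n) /
    forward_diff2 (shift_moment (mult_weights c \<alpha>)) 0"
    using assms unfolding Suc by (simp add: admissible_multiplier_def diff2_weights_sq_def)
  finally show ?case .
qed

text \<open>The left side is the integral of \<open>(t - x)\<^sup>2\<close> against the Berger
  measure.\<close>

lemma subnormal_shift_quadratic:
  assumes "subnormal_shift \<alpha>"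
  shows "shift_moment \<alpha> 2 - 2 * x * shift_moment \<alpha> 1 + x\<^sup>2 * shift_moment \<alpha> 0 \<ge> 0"
proof -
  obtain \<mu> :: "real measure" and K where "prob_space \<mu>" and sets: "sets \<mu> = sets borel"
    and K: "compact K" "AE t in \<mu>. t \<in> K"
    and mom: "\<And>n. shift_moment \<alpha> n = (LINT t|\<mu>. t ^ n)"
    using assms unfolding subnormal_shift_def by blast
  interpret prob_space \<mu> by fact
  obtain B where B: "\<And>t. t \<in> K \<Longrightarrow> \<bar>t\<bar> \<le> B"
    using compact_imp_bounded[OF K(1)] unfolding bounded_iff by force
  have int: "integrable \<mu> (\<lambda>t. t ^ n)" for n
  proof (rule integrable_const_bound)
    show "AE t in \<mu>. norm (t ^ n) \<le> B ^ n"
      using K(2) by eventually_elim (auto simp: power_abs intro!: power_mono B)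
    show "(\<lambda>t. t ^ n) \<in> borel_measurable \<mu>"
      unfolding measurable_cong_sets[OF sets refl] by measurable
  qed
  have "has_bochner_integral \<mu> (\<lambda>t. t ^ 2 - 2 * x * t ^ 1 + x\<^sup>2 * t ^ 0)
    (shift_moment \<alpha> 2 - 2 * x * shift_moment \<alpha> 1 + x\<^sup>2 * shift_moment \<alpha> 0)"
    unfolding mom
    by (intro has_bochner_integral_add has_bochner_integral_diff has_bochner_integral_mult_right
        has_bochner_integral_integrable int)
  moreover have "(\<lambda>t. t ^ 2 - 2 * x * t ^ 1 + x\<^sup>2 * t ^ 0) = (\<lambda>t. (t - x)\<^sup>2)"
    by (simp add: power2_diff fun_eq_iff)
  ultimately show ?thesis
    using Bochner_Integration.integral_nonneg[of \<mu> "\<lambda>t. (t - x)\<^sup>2"] by (simp only: has_bochner_integral_iff) simp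
qed

text \<open>All new squared weights equal \<open>r\<close>, whatever the sign of \<open>A\<close>,
  so the Berger measure is the point mass at \<open>r\<close>.\<close>

lemma geometric_diff2:
  assumes E: "\<And>n. forward_diff2 (shift_moment (mult_weights c \<alpha>)) n = A * r ^ n"
    and "A \<noteq> 0" "r > 0" "c > 0"
  shows "admissible_multiplier \<alpha> c" and "subnormal_shift (diff2_weights (mult_weights c \<alpha>))"
proof -
  have sq: "diff2_weights_sq (mult_weights c \<alpha>) n = r" for n
    using assms unfolding diff2_weights_sq_def E by simp
  show "admissible_multiplier \<alpha> c"
    using assms unfolding admissible_multiplier_def sq E by simp
  have "shift_moment (diff2_weights (mult_weights c \<alpha>)) n = r ^ n" for n
    using assms(3) by (simp add: shift_moment_def diff2_weights_def sq)
  then show "subnormal_shift (diff2_weights (mult_weights c \<alpha>))"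
    unfolding subnormal_shift_def using assms(3)
    by (intro exI[of _ "return borel r"] conjI exI[of _ "{r}"])
      (auto simp: prob_space_return AE_return integral_return)
qed

lemma sum_two_geometric_not_subnormal:
  assumes adm: "admissible_multiplier \<alpha> c"
    and E: "\<And>n. forward_diff2 (shift_moment (mult_weights c \<alpha>)) n = A * x ^ n + B * y ^ n"
    and "A > 0" "B < 0" "x \<noteq> y"
  shows "\<not> subnormal_shift (diff2_weights (mult_weights c \<alpha>))"
proof
  \<comment> \<open>Integrating \<open>(t - x)\<^sup>2\<close> and \<open>(t - y)\<^sup>2\<close> against the Berger measure gives values of
    opposite signs.\<close>
  assume sub: "subnormal_shift (diff2_weights (mult_weights c \<alpha>))"
  have AB: "A + B \<noteq> 0"
    using adm E[of 0] unfolding admissible_multiplier_def by (metis mult.right_neutral power_0)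
  have combine: "u / s - 2 * z * (w / s) + z\<^sup>2 = (u - 2 * z * w + z\<^sup>2 * s) / s"
    if "s \<noteq> 0" for u w s z :: real
    using that by (simp add: field_simps)
  have *: "0 \<le> ((A * (x - z)\<^sup>2 + B * (y - z)\<^sup>2) / (A + B))" for z
  proof -
    have "0 \<le> (A * x\<^sup>2 + B * y\<^sup>2) / (A + B) - 2 * z * ((A * x + B * y) / (A + B)) + z\<^sup>2"
      using subnormal_shift_quadratic[OF sub, of z] AB
      unfolding shift_moment_diff2_weights[OF adm] E by simp
    also have "\<dots> = (A * x\<^sup>2 + B * y\<^sup>2 - 2 * z * (A * x + B * y) + z\<^sup>2 * (A + B)) / (A + B)"
      using combine[OF AB] .
    also have "A * x\<^sup>2 + B * y\<^sup>2 - 2 * z * (A * x + B * y) + z\<^sup>2 * (A + B) =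
        A * (x - z)\<^sup>2 + B * (y - z)\<^sup>2"
      by (simp add: power2_eq_square algebra_simps)
    finally show ?thesis .
  qed
  have "0 \<le> B * (y - x)\<^sup>2 / (A + B)" "0 \<le> A * (x - y)\<^sup>2 / (A + B)"
    using *[of x] *[of y] by simp_all
  moreover have "B * (y - x)\<^sup>2 < 0" "A * (x - y)\<^sup>2 > 0"
    using assms by (simp_all add: mult_neg_pos)
  ultimately show False
    using AB by (auto simp: zero_le_divide_iff)
qed

section \<open>The moments of the multiplied shift as series of powers\<close>

lemma shift_moment_ND:
  assumes p: "p > 1" and ND: "(N, D) \<in> ND_square"
  shows "shift_moment (mult_weights c (ND_weights p N D)) n =
    (c\<^sup>2) ^ n * (\<Prod>i<n. (1 + N * (1 / p) ^ i) / (1 + D * (1 / p) ^ i))"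
proof -
  have "(mult_weights c (ND_weights p N D) i)\<^sup>2 =
    c\<^sup>2 * ((1 + N * (1 / p) ^ i) / (1 + D * (1 / p) ^ i))" for i
  proof -
    have "p ^ i \<ge> 1"
      using p by simp
    then have pos: "p ^ i + N > 0" "p ^ i + D > 0"
      using ND unfolding ND_square_def by auto
    then have "(mult_weights c (ND_weights p N D) i)\<^sup>2 = c\<^sup>2 * ((p ^ i + N) / (p ^ i + D))"
      by (simp add: mult_weights_def ND_weights_def power_mult_distrib)
    also have "(p ^ i + N) / (p ^ i + D) = (1 + N * (1 / p) ^ i) / (1 + D * (1 / p) ^ i)"
      using pos p by (simp add: divide_simps)
    finally show ?thesis .
  qed
  then show ?thesis
    by (simp only: shift_moment_def prod.distrib prod_constant card_lessThan)
qed

text \<open>One constant \<open>C\<close> serves every multiplier: \<open>c\<close> enters only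
  through the positions of the atoms.\<close>

lemma shift_moment_ND_sums:
  assumes p: "p > 1" and ND: "(N, D) \<in> ND_square"
  obtains C where "C > 0"
    "\<And>c n. (\<lambda>j. C * qcoeff (1 / p) N D j * (c\<^sup>2 * (1 / p) ^ j) ^ n) sums
      shift_moment (mult_weights c (ND_weights p N D)) n"
proof -
  have bounds: "0 < 1 / p" "1 / p < 1" "\<bar>N\<bar> < 1" "\<bar>D\<bar> < 1"
    using p ND by (auto simp: ND_square_def)
  obtain C where "C > 0" and C: "\<And>n. (\<lambda>j. C * qcoeff (1 / p) N D j * ((1 / p) ^ j) ^ n) sums
      (\<Prod>i<n. (1 + N * (1 / p) ^ i) / (1 + D * (1 / p) ^ i))"
    by (rule qcoeff_sums[OF bounds]) blast
  show thesis
  proof (rule that[OF \<open>C > 0\<close>])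
    fix c :: real and n
    show "(\<lambda>j. C * qcoeff (1 / p) N D j * (c\<^sup>2 * (1 / p) ^ j) ^ n) sums
      shift_moment (mult_weights c (ND_weights p N D)) n"
      using sums_mult[OF C[of n], of "(c\<^sup>2) ^ n"]
      unfolding shift_moment_ND[OF p ND] by (simp only: power_mult_distrib mult.left_commute)
  qed
qed

lemma cpd_ND_qcoeff_nonneg:
  assumes p: "p > 1" and ND: "(N, D) \<in> ND_square" and c: "c > 0"
    and cpd: "cpd_shift (mult_weights c (ND_weights p N D))" and j: "c\<^sup>2 \<noteq> p ^ j"
  shows "qcoeff (1 / p) N D j \<ge> 0"
proof -
  obtain C where C: "C > 0" and sums: "\<And>n. (\<lambda>j. C * qcoeff (1 / p) N D j * (c\<^sup>2 * (1 / p) ^ j) ^ n) sums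
      shift_moment (mult_weights c (ND_weights p N D)) n"
    using shift_moment_ND_sums[OF p ND] by metis
  have "0 \<le> C * qcoeff (1 / p) N D j"
  proof (rule cpd_shift_coeff_nonneg[OF sums _ _ _ cpd])
    have "summable (\<lambda>j. \<bar>qcoeff (1 / p) N D j\<bar>)"
      using p ND by (intro summable_qcoeff) (auto simp: ND_square_def)
    then show "summable (\<lambda>j. \<bar>C * qcoeff (1 / p) N D j\<bar>)"
      unfolding abs_mult by (rule summable_mult)
    show "c\<^sup>2 * (1 / p) ^ l > 0" for l
      using p c by simp
    show "c\<^sup>2 * (1 / p) ^ j < c\<^sup>2 * (1 / p) ^ i" if "i < j" for i j
      using p c that by (intro mult_strict_left_mono power_strict_decreasing) auto
    show "c\<^sup>2 * (1 / p) ^ j \<noteq> 1"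
      using j p by (simp add: field_simps power_divide)
  qed
  then show ?thesis
    using C by (simp add: zero_le_mult_iff)
qed

section \<open>Sign patterns of the coefficients\<close>

lemma sgn_qcoeff_Suc:
  assumes "0 < q" "q < 1"
  shows "sgn (qcoeff q N D (Suc j)) = sgn (qcoeff q N D j) * sgn (D * q ^ j - N)"
proof -
  have "q ^ Suc j < 1"
    using assms power_Suc_less_one by blast
  then show ?thesis
    unfolding qcoeff_Suc by (simp add: sgn_mult sgn_divide)
qed

text \<open>From index \<open>n\<close> on the coefficients are nonzero with alternating signs, so
  two of any four consecutive ones are negative.\<close>

lemma two_negative_qcoeffs:
  assumes q: "0 < q" "q < 1"
    and n: "qcoeff q N D n \<noteq> 0" "\<And>j. j \<ge> n \<Longrightarrow> D * q ^ j < N"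
  obtains i j where "i \<noteq> j" "qcoeff q N D i < 0" "qcoeff q N D j < 0"
proof -
  have S: "sgn (qcoeff q N D (Suc j)) = - sgn (qcoeff q N D j)" if "j \<ge> n" for j
    using n(2)[OF that] by (simp add: sgn_qcoeff_Suc[OF q])
  have s: "sgn (qcoeff q N D (Suc (Suc n))) = sgn (qcoeff q N D n)"
    "sgn (qcoeff q N D (Suc (Suc (Suc n)))) = sgn (qcoeff q N D (Suc n))"
    by (simp_all add: S)
  show thesis
  proof (cases "qcoeff q N D n < 0")
    case True
    then show thesis
      using s by (intro that[of n "Suc (Suc n)"]) (auto simp: sgn_if split: if_splits)
  next
    case False
    then have "qcoeff q N D (Suc n) < 0"
      using n(1) S[of n] by (auto simp: sgn_if split: if_splits)
    then show thesis
      using s by (intro that[of "Suc n" "Suc (Suc (Suc n))"]) (auto simp: sgn_if split: if_splits)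
  qed
qed

text \<open>For \<open>N \<ge> 0\<close> the factors are eventually negative and the signs
  alternate. For \<open>N < 0\<close> coefficient 1 is negative; the second negative one has index 2
  above \<open>D = p * N\<close> and index 3 below \<open>D = p\<^sup>2 * N\<close>.\<close>

lemma two_negative_qcoeffs_outside:
  assumes p: "p > 1" and ND: "(N, D) \<in> ND_square"
    and out: "(N, D) \<notin> subsector_VIIIB p \<union> sector_I \<union> sector_II \<union> sector_III \<union> special_lines_IV p"
  obtains i j where "i \<noteq> j" "qcoeff (1 / p) N D i < 0" "qcoeff (1 / p) N D j < 0"
proof -
  let ?q = "1 / p"
  have q: "0 < ?q" "?q < 1"
    using p by auto
  \<comment> \<open>Sectors I, II and III together fill the part of the square with
    \<open>N \<le> 0\<close> and \<open>D \<ge> N\<close>.\<close>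
  have N: "N \<le> 0 \<Longrightarrow> D < N"
    using out ND by (auto simp: sector_I_def sector_II_def sector_III_def)
  consider "N > 0" | "N = 0" | "N < 0" by linarith
  then show thesis
  proof cases
    case 1
    \<comment> \<open>A factor vanishes, making all later coefficients 0, exactly on a line
      \<open>D = p ^ i * N\<close>; for \<open>N > 0\<close> it lies in Sector IV.\<close>
    have nz: "D * ?q ^ i - N \<noteq> 0" for i
    proof
      assume "D * ?q ^ i - N = 0"
      then have D: "D = p ^ i * N"
        using p by (simp add: field_simps power_divide)
      moreover have "N \<le> p ^ i * N"
        using 1 p by simp
      ultimately have "(N, D) \<in> special_lines_IV p"
        using ND 1 by (auto simp: special_lines_IV_def sector_IV_def)
      with out show False by blast
    qed
    have "(\<lambda>j. D * ?q ^ j) \<longlonglongrightarrow> D * 0"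
      using q by (intro tendsto_intros LIMSEQ_realpow_zero) auto
    then have "\<forall>\<^sub>F j in sequentially. D * ?q ^ j < N"
      using 1 by (intro order_tendstoD) auto
    then obtain n where n: "\<And>j. j \<ge> n \<Longrightarrow> D * ?q ^ j < N"
      by (auto simp: eventually_sequentially)
    have "sgn (qcoeff ?q N D k) \<noteq> 0" for k
    proof (induction k)
      case (Suc k)
      then show ?case
        using nz[of k] unfolding sgn_qcoeff_Suc[OF q] by (simp only: mult_eq_0_iff sgn_zero_iff simp_thms)
    qed (simp add: qcoeff_def)
    then have "qcoeff ?q N D n \<noteq> 0"
      by (simp only: sgn_zero_iff simp_thms)
    from two_negative_qcoeffs[OF q this n] that show thesis
      by blast
  next
    case 2
    then have "D * ?q ^ j < N" for j
      using N p by (simp add: mult_neg_pos)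
    then show thesis
      using two_negative_qcoeffs[OF q, of N D 0] that by (auto simp: qcoeff_def)
  next
    case 3
    then have D: "D < N" "D < 0"
      using N by auto
    then have s0: "qcoeff ?q N D 1 < 0"
      using q by (simp add: qcoeff_def divide_neg_pos)
    then have s1: "sgn (qcoeff ?q N D 1) = -1" by simp
    have s2: "sgn (qcoeff ?q N D 2) = - sgn (D * ?q - N)"
      using sgn_qcoeff_Suc[OF q, of N D 1] s1 by (simp add: numeral_2_eq_2)
    from out ND 3 have "D > p * N \<or> D < p\<^sup>2 * N"
      by (auto simp: subsector_VIIIB_def)
    then show thesis
    proof
      assume "D > p * N"
      then have "D * ?q - N > 0"
        using p by (simp add: field_simps)
      then have "qcoeff ?q N D 2 < 0"
        using s2 by (simp add: sgn_if split: if_splits)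
      then show thesis
        using that[of 1 2] s0 by simp
    next
      assume "D < p\<^sup>2 * N"
      then have neg: "D * ?q\<^sup>2 - N < 0"
        using p by (simp add: field_simps)
      have "D * ?q \<le> D * ?q\<^sup>2"
        using D q power_decreasing[of 1 2 ?q] by (intro mult_left_mono_neg) auto
      with neg have "D * ?q - N < 0" by linarith
      with s2 have "sgn (qcoeff ?q N D 2) = 1" by simp
      then have "sgn (qcoeff ?q N D 3) = -1"
        using sgn_qcoeff_Suc[OF q, of N D 2] neg by (simp add: numeral_3_eq_3 numeral_2_eq_2)
      then have "qcoeff ?q N D 3 < 0"
        by (simp add: sgn_if split: if_splits)
      then show thesis
        using that[of 1 3] s0 by simp
    qed
  qed
qed

text \<open>Since \<open>D < 0\<close>, the numerators \<open>D * q ^ i - N\<close>, with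
  \<open>q = 1 / p\<close>, increase with \<open>i\<close>: they are negative for
  \<open>i = 0, 1\<close> and nonnegative from \<open>i = 2\<close> on. Hence the sign changes
  exactly twice at the start.\<close>

lemma qcoeff_signs_VIIIB:
  assumes p: "p > 1" and N: "N < 0" and D: "p\<^sup>2 * N \<le> D" "D < p * N"
  shows "qcoeff (1 / p) N D 1 < 0" and "j \<noteq> 1 \<Longrightarrow> qcoeff (1 / p) N D j \<ge> 0"
proof -
  let ?q = "1 / p"
  have q: "0 < ?q" "?q < 1"
    using p by auto
  have "p * N < N"
    using p N by simp
  then have "D < N" "D < 0"
    using D N by linarith+
  then show s1: "qcoeff ?q N D 1 < 0"
    using q by (simp add: qcoeff_def divide_neg_pos)
  have "D * ?q - N < 0"
    using p D by (simp add: field_simps)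
  then have s2: "qcoeff ?q N D 2 \<ge> 0"
    using sgn_qcoeff_Suc[OF q, of N D 1] s1 by (auto simp: numeral_2_eq_2 sgn_if split: if_splits)
  have "D * ?q\<^sup>2 - N \<ge> 0"
    using p D by (simp add: field_simps)
  moreover have "D * ?q\<^sup>2 \<le> D * ?q ^ (2 + i)" for i
    using q \<open>D < 0\<close> by (intro mult_left_mono_neg power_decreasing) auto
  ultimately have fac: "D * ?q ^ (2 + i) - N \<ge> 0" for i
    by (meson diff_mono order_refl order_trans)
  have "qcoeff ?q N D (2 + i) \<ge> 0" for i
  proof (induction i)
    case (Suc i)
    have "?q ^ Suc (2 + i) < 1"
      using q power_Suc_less_one by blast
    then have "qcoeff ?q N D (Suc (2 + i)) \<ge> 0"
      unfolding qcoeff_Suc by (intro mult_nonneg_nonneg divide_nonneg_pos Suc fac) simp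
    then show ?case by simp
  qed (use s2 in simp)
  note tail = this
  assume "j \<noteq> 1"
  then consider "j = 0" | i where "j = 2 + i"
    by (metis One_nat_def add_2_eq_Suc not0_implies_Suc)
  then show "qcoeff ?q N D j \<ge> 0"
    using tail by cases (simp_all add: qcoeff_def)
qed

text \<open>On \<open>D = p * N\<close> each numerator equals the next denominator, so the moment
  product telescopes and leaves two atoms, \<open>c\<^sup>2\<close> and
  \<open>c\<^sup>2 / p\<close>.\<close>

lemma forward_diff2_ND_edge:
  assumes p: "p > 1" and ND: "(N, p * N) \<in> ND_square"
  shows "forward_diff2 (shift_moment (mult_weights c (ND_weights p N (p * N)))) n =
    (c\<^sup>2 - 1)\<^sup>2 / (1 + p * N) * (c\<^sup>2) ^ n + p * N * (c\<^sup>2 / p - 1)\<^sup>2 / (1 + p * N) * (c\<^sup>2 / p) ^ n"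
proof -
  have "\<bar>p * N * (1 / p) ^ i\<bar> \<le> \<bar>p * N\<bar>" for i
    using p unfolding abs_mult by (intro mult_left_le) (auto simp: power_le_one)
  moreover have "\<bar>p * N\<bar> < 1"
    using ND by (auto simp: ND_square_def)
  ultimately have pos: "1 + p * N * (1 / p) ^ i > 0" for i
    by (smt (verit))
  have mom: "shift_moment (mult_weights c (ND_weights p N (p * N))) n =
    (c\<^sup>2) ^ n * ((1 + p * N * (1 / p) ^ n) / (1 + p * N))" for n
  proof -
    have "(\<Prod>i<n. (1 + N * (1 / p) ^ i) / (1 + p * N * (1 / p) ^ i)) =
      (\<Prod>i<n. (1 + p * N * (1 / p) ^ Suc i) / (1 + p * N * (1 / p) ^ i))"
      using p by simp
    also have "\<dots> = (1 + p * N * (1 / p) ^ n) / (1 + p * N * (1 / p) ^ 0)"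
      using pos by (intro prod_lessThan_telescope) (auto simp: less_imp_neq[symmetric])
    finally show ?thesis
      unfolding shift_moment_ND[OF p ND] by simp
  qed
  \<comment> \<open>Here \<open>k\<close> is the squared multiplier, \<open>q\<close> is
    \<open>1 / p\<close>, \<open>K\<close> and \<open>Q\<close> are the n-th powers of
    \<open>k\<close> and \<open>q\<close>, \<open>M\<close> is \<open>p * N\<close>, and
    \<open>t\<close> is the inverse of \<open>1 + p * N\<close>.\<close>
  have "k * (k * K) * ((1 + M * (q * (q * Q))) * t) - 2 * (k * K * ((1 + M * (q * Q)) * t)) +
      K * ((1 + M * Q) * t) = (k - 1)\<^sup>2 * t * K + M * (k * q - 1)\<^sup>2 * t * (K * Q)" for k K M q Q t :: real
    by (simp add: algebra_simps power2_eq_square)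
  then show ?thesis
    unfolding forward_diff2_eq mom
    by (simp only: power_Suc divide_inverse power_mult_distrib mult_1)
qed

theorem theorem3p7:
  fixes p N D :: real
  assumes "p > 1" and "(N, D) \<in> ND_square"
  shows
    "(-1 < p\<^sup>2 * N \<and> p\<^sup>2 * N \<le> D \<and> D \<le> p * N \<and> p * N < 0 \<and> D \<noteq> p * N \<longrightarrow>
        {c. admissible_multiplier (ND_weights p N D) c \<and>
            cpd_shift (mult_weights c (ND_weights p N D))} = {sqrt p}) \<and>
     (-1 < p\<^sup>2 * N \<and> p\<^sup>2 * N \<le> D \<and> D \<le> p * N \<and> p * N < 0 \<and> D = p * N \<longrightarrow>
        {c. admissible_multiplier (ND_weights p N D) c \<and>
            subnormal_shift (diff2_weights (mult_weights c (ND_weights p N D)))} = {1, sqrt p}) \<and>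
     ((N, D) \<notin> subsector_VIIIB p \<union> sector_I \<union> sector_II \<union> sector_III \<union> special_lines_IV p \<longrightarrow>
        \<not> (\<exists>c. admissible_multiplier (ND_weights p N D) c \<and>
            cpd_shift (mult_weights c (ND_weights p N D))))"
proof (intro conjI impI)
  assume *: "-1 < p\<^sup>2 * N \<and> p\<^sup>2 * N \<le> D \<and> D \<le> p * N \<and> p * N < 0 \<and> D \<noteq> p * N"
  let ?w = "\<lambda>c. mult_weights c (ND_weights p N D)" and ?qc = "qcoeff (1 / p) N D"
  have "N < 0" "D < p * N"
    using * \<open>p > 1\<close> by (auto simp: mult_less_0_iff)
  then have signs: "?qc 1 < 0" "\<And>j. j \<noteq> 1 \<Longrightarrow> ?qc j \<ge> 0"
    using qcoeff_signs_VIIIB[OF \<open>p > 1\<close>] * by blast+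
  obtain C where C: "C > 0" and "\<And>c n. (\<lambda>j. C * ?qc j * (c\<^sup>2 * (1 / p) ^ j) ^ n) sums shift_moment (?w c) n"
    using shift_moment_ND_sums[OF assms] by metis
  from this(2)[of "sqrt p"] have sums:
    "\<And>n. (\<lambda>j. C * ?qc j * (p * (1 / p) ^ j) ^ n) sums shift_moment (?w (sqrt p)) n"
    using \<open>p > 1\<close> by simp
  \<comment> \<open>The multiplier \<open>sqrt p\<close> puts atom 1, the only one of negative mass,
    at the point 1.\<close>
  have nonneg: "C * ?qc j \<ge> 0" if "p * (1 / p) ^ j \<noteq> 1" for j
    using signs(2)[of j] that C \<open>p > 1\<close> by (cases "j = 1") auto
  have "cpd_shift (?w (sqrt p))"
    using \<open>p > 1\<close> by (intro cpd_shiftI[OF sums] nonneg) auto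
  \<comment> \<open>The factor \<open>(x - 1)\<^sup>2\<close> kills the negative mass, and atom 0,
    at \<open>p\<close>, contributes strictly. Positivity then yields both halves of
    admissibility.\<close>
  moreover have pos: "forward_diff2 (shift_moment (?w (sqrt p))) n > 0" for n
  proof -
    let ?t = "\<lambda>j. C * ?qc j * (p * (1 / p) ^ j - 1)\<^sup>2 * (p * (1 / p) ^ j) ^ n"
    have s: "?t sums forward_diff2 (shift_moment (?w (sqrt p))) n"
      by (rule forward_diff2_sums[OF sums])
    have "?t j \<ge> 0" for j
      using nonneg[of j] \<open>p > 1\<close> by (cases "p * (1 / p) ^ j = 1") auto
    moreover have "?t 0 > 0"
      using C \<open>p > 1\<close> by (simp add: qcoeff_def)
    ultimately have "0 < suminf ?t"
      by (rule suminf_pos2[OF sums_summable[OF s]])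
    then show ?thesis
      using sums_unique[OF s] by simp
  qed
  then have "admissible_multiplier (ND_weights p N D) (sqrt p)"
    using \<open>p > 1\<close> pos[THEN less_imp_le] pos[THEN less_imp_neq, symmetric]
    by (auto simp: admissible_multiplier_def diff2_weights_sq_def intro!: divide_nonneg_nonneg)
  moreover have "c = sqrt p" if "c > 0" "cpd_shift (?w c)" for c
  proof -
    have "c\<^sup>2 = p"
      using cpd_ND_qcoeff_nonneg[OF assms that, of 1] signs(1) by auto
    then show ?thesis
      using that by (simp add: real_sqrt_unique)
  qed
  ultimately show "{c. admissible_multiplier (ND_weights p N D) c \<and> cpd_shift (?w c)} = {sqrt p}"
    by (auto simp: admissible_multiplier_def)
next
  assume *: "-1 < p\<^sup>2 * N \<and> p\<^sup>2 * N \<le> D \<and> D \<le> p * N \<and> p * N < 0 \<and> D = p * N"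
  let ?\<alpha> = "ND_weights p N D"
  have pN: "p * N < 0" "1 + p * N > 0" "N \<noteq> 0"
    using * assms by (auto simp: ND_square_def)
  have E: "forward_diff2 (shift_moment (mult_weights c ?\<alpha>)) n =
    (c\<^sup>2 - 1)\<^sup>2 / (1 + p * N) * (c\<^sup>2) ^ n + p * N * (c\<^sup>2 / p - 1)\<^sup>2 / (1 + p * N) * (c\<^sup>2 / p) ^ n" for c n
    using forward_diff2_ND_edge[OF \<open>p > 1\<close>, of N] * assms by simp
  \<comment> \<open>For any other multiplier both atoms survive, with masses of opposite
    sign.\<close>
  have "c \<in> {1, sqrt p}"
    if adm: "admissible_multiplier ?\<alpha> c" and sub: "subnormal_shift (diff2_weights (mult_weights c ?\<alpha>))" for c
  proof (rule ccontr)
    assume c: "c \<notin> {1, sqrt p}"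
    have "c > 0"
      using adm by (simp add: admissible_multiplier_def)
    then have "c\<^sup>2 \<noteq> 1" "c\<^sup>2 \<noteq> p"
      using c by (auto simp: power2_eq_1_iff real_sqrt_unique)
    then have "(c\<^sup>2 - 1)\<^sup>2 / (1 + p * N) > 0" "p * N * (c\<^sup>2 / p - 1)\<^sup>2 / (1 + p * N) < 0"
      using pN \<open>p > 1\<close> by (auto intro!: divide_neg_pos mult_neg_pos)
    moreover have "c\<^sup>2 \<noteq> c\<^sup>2 / p"
      using \<open>c > 0\<close> \<open>p > 1\<close> by (simp add: field_simps)
    ultimately show False
      using sum_two_geometric_not_subnormal[OF adm E] sub by blast
  qed
  moreover
  \<comment> \<open>Multiplier 1 removes the positive mass. The second differences are then all
    negative, but their ratios are positive.\<close>
  have E1: "forward_diff2 (shift_moment (mult_weights 1 ?\<alpha>)) n =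
      p * N * (1 / p - 1)\<^sup>2 / (1 + p * N) * (1 / p) ^ n" for n
    using E[of 1 n] by simp
  have "admissible_multiplier ?\<alpha> 1" "subnormal_shift (diff2_weights (mult_weights 1 ?\<alpha>))"
    using pN \<open>p > 1\<close> by (auto intro!: geometric_diff2[OF E1])
  moreover
  have Ep: "forward_diff2 (shift_moment (mult_weights (sqrt p) ?\<alpha>)) n =
      (p - 1)\<^sup>2 / (1 + p * N) * p ^ n" for n
    using E[of "sqrt p" n] \<open>p > 1\<close> by simp
  have "admissible_multiplier ?\<alpha> (sqrt p)"
    "subnormal_shift (diff2_weights (mult_weights (sqrt p) ?\<alpha>))"
    using pN \<open>p > 1\<close> by (auto intro!: geometric_diff2[OF Ep])
  ultimately show "{c. admissible_multiplier ?\<alpha> c \<and>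
      subnormal_shift (diff2_weights (mult_weights c ?\<alpha>))} = {1, sqrt p}"
    by blast
next
  assume "(N, D) \<notin> subsector_VIIIB p \<union> sector_I \<union> sector_II \<union> sector_III \<union> special_lines_IV p"
  then obtain i j where ij: "i \<noteq> j" "qcoeff (1 / p) N D i < 0" "qcoeff (1 / p) N D j < 0"
    using two_negative_qcoeffs_outside[OF assms] by metis
  show "\<not> (\<exists>c. admissible_multiplier (ND_weights p N D) c \<and> cpd_shift (mult_weights c (ND_weights p N D)))"
  proof
    assume "\<exists>c. admissible_multiplier (ND_weights p N D) c \<and> cpd_shift (mult_weights c (ND_weights p N D))"
    then obtain c where "c > 0" "cpd_shift (mult_weights c (ND_weights p N D))"
      by (auto simp: admissible_multiplier_def)
    \<comment> \<open>Each negative coefficient would need its own atom at 1, but distinct atoms lie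
      at distinct points.\<close>
    from cpd_ND_qcoeff_nonneg[OF assms this] ij have "c\<^sup>2 = p ^ i" "c\<^sup>2 = p ^ j"
      by (meson not_le)+
    then show False
      using ij(1) \<open>p > 1\<close> by simp
  qed
qed

end
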